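(* Let $G$ be a graph. A set $X\subseteq V(G)$ is a $\frac{1}{2}$-independent set if and only if $\overline{X}=V(G)\setminus X$ is a global $(\mathbb{Z},\{o\in\mathbb{Z} : o\geq 0\})$-alliance.
   Context: Graphs are finite and simple. For a graph $G=(V,E)$, $S\subseteq V$ and $v\in V$, $N_S(v)$ is the set of neighbors of $v$ lying in $S$, $\delta_S(v)=|N_S(v)|$, $\overline{S}=V\setminus S$, $N(v)=N_V(v)$ is the open neighborhood, $N(S)=\bigcup_{u\in S}N(u)$ and $N[S]=N(S)\cup S$. A set $S$ is dominating if $N[S]=V$. For $D,O\subseteq\mathbb{Z}$, a $(D,O)$-alliance in $G$ is a vertex set $S$ such that (1) $\delta_S(v)-\delta_{\overline{S}}(v)\in D$ for all $v\in S$, and (2) $\delta_S(v)-\delta_{\overline{S}}(v)\in O$ for all $v\in N(S)\setminus S$. It is called global if $S$ is also a dominating set. For $0<\alpha\le 1$, an $\alpha$-independent set in $G$ is a vertex set $X$ such that $|N(v)\cap X|\leq \alpha|N(v)|$ for all $v\in X$.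
   Formalization: The formal theorem additionally assumes that no vertex of X is isolated in G; without this the claim fails, e.g. for G a single vertex and X = V(G), which is 1/2-independent while its complement, the empty set, is not dominating. *)

theory Defs
  imports Complex_Main "Graph_Theory.Digraph"
begin

text \<open>
  Finite simple graphs are the structures satisfying the locale predicate \<^const>\<open>graph\<close>:
  finite symmetric digraphs without loops and parallel arcs, so that an undirected edge is a
  pair of opposite arcs.
\<close>

definition nbrs_in :: "('a, 'b) pre_digraph \<Rightarrow> 'a set \<Rightarrow> 'a \<Rightarrow> 'a set" where
  "nbrs_in G S v = {u \<in> S. v \<rightarrow>\<^bsub>G\<^esub> u}"

definition deg_in :: "('a, 'b) pre_digraph \<Rightarrow> 'a set \<Rightarrow> 'a \<Rightarrow> nat" where
  "deg_in G S v = card (nbrs_in G S v)"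

definition open_nbhd :: "('a, 'b) pre_digraph \<Rightarrow> 'a \<Rightarrow> 'a set" where
  "open_nbhd G v = nbrs_in G (verts G) v"

definition open_nbhd_set :: "('a, 'b) pre_digraph \<Rightarrow> 'a set \<Rightarrow> 'a set" where
  "open_nbhd_set G S = (\<Union>u\<in>S. open_nbhd G u)"

definition closed_nbhd_set :: "('a, 'b) pre_digraph \<Rightarrow> 'a set \<Rightarrow> 'a set" where
  "closed_nbhd_set G S = open_nbhd_set G S \<union> S"

definition dominating_set :: "('a, 'b) pre_digraph \<Rightarrow> 'a set \<Rightarrow> bool" where
  "dominating_set G S \<longleftrightarrow> S \<subseteq> verts G \<and> closed_nbhd_set G S = verts G"

definition alliance :: "int set \<Rightarrow> int set \<Rightarrow> ('a, 'b) pre_digraph \<Rightarrow> 'a set \<Rightarrow> bool" where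
  "alliance D Q G S \<longleftrightarrow> S \<subseteq> verts G \<and>
     (\<forall>v\<in>S. int (deg_in G S v) - int (deg_in G (verts G - S) v) \<in> D) \<and>
     (\<forall>v\<in>open_nbhd_set G S - S. int (deg_in G S v) - int (deg_in G (verts G - S) v) \<in> Q)"

definition global_alliance :: "int set \<Rightarrow> int set \<Rightarrow> ('a, 'b) pre_digraph \<Rightarrow> 'a set \<Rightarrow> bool" where
  "global_alliance D Q G S \<longleftrightarrow> alliance D Q G S \<and> dominating_set G S"

definition alpha_independent :: "real \<Rightarrow> ('a, 'b) pre_digraph \<Rightarrow> 'a set \<Rightarrow> bool" where
  "alpha_independent \<alpha> G X \<longleftrightarrow> X \<subseteq> verts G \<and>
     (\<forall>v\<in>X. real (card (open_nbhd G v \<inter> X)) \<le> \<alpha> * real (card (open_nbhd G v)))"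

text \<open>
  Pitfall: an isolated vertex may belong to an \<open>\<alpha>\<close>-independent set \<open>X\<close>, but it is never dominated
  by \<open>verts G - X\<close>. For \<open>G\<close> a single vertex, \<open>X = verts G\<close> is \<open>\<alpha>\<close>-independent, yet its complement,
  the empty set, is not dominating. Relating \<open>\<alpha>\<close>-independence of \<open>X\<close> to globality of the alliance
  \<open>verts G - X\<close> therefore needs the assumption that \<open>X\<close> contains no isolated vertex; when
  \<open>verts G - X\<close> is dominating, this holds automatically.
\<close>

end

theory Submission
  imports Defs
begin

text \<open>
  Write \<open>S\<close> for the complement of \<open>X\<close>. The degree of a vertex splits as the sum of its degrees into
  \<open>S\<close> and into \<open>X\<close>, so for \<open>v \<in> X\<close> the bound of \<open>1/2\<close>-independence says precisely that \<open>v\<close> has at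
  least as many neighbours in \<open>S\<close> as in \<open>X\<close>, which is the alliance condition at \<open>v\<close>
  (\<open>half_bound_iff_deg_diff_nonneg\<close>). It remains to compare the vertices at which the two notions
  impose this condition: all of \<open>X\<close> on one side, and \<open>N(S) - S\<close> on the other. The
  latter is contained in \<open>X\<close>, and equals \<open>X\<close> if and only if \<open>S\<close> is dominating
  (\<open>dominating_set_compl_iff\<close>). So a global alliance meets the condition on all of \<open>X\<close>. Conversely,
  if \<open>X\<close> is \<open>1/2\<close>-independent, a vertex of \<open>X\<close> has some neighbour by assumption, hence one in
  \<open>S\<close>, so \<open>S\<close> dominates.
\<close>

lemma deg_in_split:
  assumes "graph G" and "X \<subseteq> verts G"
  shows "card (open_nbhd G v) = deg_in G X v + deg_in G (verts G - X) v"
proof -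
  interpret graph G by fact
  have "open_nbhd G v = nbrs_in G X v \<union> nbrs_in G (verts G - X) v"
    using assms(2) by (auto simp: open_nbhd_def nbrs_in_def)
  moreover have "finite (nbrs_in G X v)" "finite (nbrs_in G (verts G - X) v)"
    using finite_verts assms(2) by (auto simp: nbrs_in_def intro: finite_subset)
  moreover have "nbrs_in G X v \<inter> nbrs_in G (verts G - X) v = {}"
    by (auto simp: nbrs_in_def)
  ultimately show ?thesis
    by (simp add: deg_in_def card_Un_disjoint)
qed

lemma open_nbhd_Int:
  assumes "X \<subseteq> verts G"
  shows "open_nbhd G v \<inter> X = nbrs_in G X v"
  using assms by (auto simp: open_nbhd_def nbrs_in_def)

lemma half_bound_iff_deg_diff_nonneg:
  assumes "graph G" and "X \<subseteq> verts G"
  shows "real (card (open_nbhd G v \<inter> X)) \<le> 1/2 * real (card (open_nbhd G v)) \<longleftrightarrow>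
         int (deg_in G (verts G - X) v) - int (deg_in G X v) \<ge> 0"
  using deg_in_split[OF assms, of v] open_nbhd_Int[OF assms(2), of v]
  by (auto simp: deg_in_def)

lemma mem_open_nbhd_set_iff:
  assumes "graph G" and "S \<subseteq> verts G"
  shows "v \<in> open_nbhd_set G S \<longleftrightarrow> nbrs_in G S v \<noteq> {}"
proof -
  interpret graph G by fact
  have "u \<rightarrow>\<^bsub>G\<^esub> v \<longleftrightarrow> v \<rightarrow>\<^bsub>G\<^esub> u" for u
    using sym_arcs by (auto simp: symmetric_def dest: symD)
  then show ?thesis
    by (auto simp: open_nbhd_set_def open_nbhd_def nbrs_in_def)
qed

lemma open_nbhd_set_subset_verts: "open_nbhd_set G S \<subseteq> verts G"
  by (auto simp: open_nbhd_set_def open_nbhd_def nbrs_in_def)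

lemma dominating_set_compl_iff:
  assumes "X \<subseteq> verts G"
  shows "dominating_set G (verts G - X) \<longleftrightarrow> open_nbhd_set G (verts G - X) - (verts G - X) = X"
  using assms open_nbhd_set_subset_verts[of G "verts G - X"]
  by (auto simp: dominating_set_def closed_nbhd_set_def)

theorem proposition10:
  fixes G :: "('a, 'b) pre_digraph" and X :: "'a set"
  assumes "graph G"
    and "X \<subseteq> verts G"
    and no_isolated: "\<And>v. v \<in> X \<Longrightarrow> open_nbhd G v \<noteq> {}"
  shows "alpha_independent (1/2) G X \<longleftrightarrow>
         global_alliance (UNIV :: int set) {z :: int. z \<ge> 0} G (verts G - X)"
proof -
  interpret graph G by fact
  define S where "S = verts G - X"
  define good where "good v \<longleftrightarrow> int (deg_in G S v) - int (deg_in G X v) \<ge> 0" for v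
  have compl: "verts G - S = X"
    using assms(2) by (auto simp: S_def)
  have indep: "alpha_independent (1/2) G X \<longleftrightarrow> (\<forall>v\<in>X. good v)"
    using assms(2) half_bound_iff_deg_diff_nonneg[OF assms(1,2)]
    by (simp add: alpha_independent_def good_def S_def)
  have alli: "alliance UNIV {z. z \<ge> 0} G S \<longleftrightarrow> (\<forall>v\<in>open_nbhd_set G S - S. good v)"
    by (auto simp: alliance_def good_def compl) (auto simp: S_def)
  have dom: "dominating_set G S \<longleftrightarrow> open_nbhd_set G S - S = X"
    using dominating_set_compl_iff[OF assms(2)] by (simp add: S_def)
  have dominated: "v \<in> open_nbhd_set G S" if "v \<in> X" "good v" for v
  proof -
    have "finite (open_nbhd G v)"
      using finite_verts by (auto simp: open_nbhd_def nbrs_in_def)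
    then have "card (open_nbhd G v) > 0"
      using no_isolated[OF that(1)] by (simp add: card_gt_0_iff)
    then have "deg_in G S v > 0"
      using deg_in_split[OF assms(1,2), of v] that(2)
      unfolding good_def S_def by linarith
    then have "nbrs_in G S v \<noteq> {}"
      by (auto simp: deg_in_def)
    then show ?thesis
      using mem_open_nbhd_set_iff[OF assms(1), of S v] by (simp add: S_def)
  qed
  have "dominating_set G S" if "\<forall>v\<in>X. good v"
  proof -
    have "X \<subseteq> open_nbhd_set G S"
      using dominated that by blast
    then show ?thesis
      using open_nbhd_set_subset_verts[of G S] dom by (auto simp: S_def)
  qed
  then show ?thesis
    unfolding global_alliance_def S_def[symmetric] indep alli using dom by auto
qed

end
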